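(* Let $\mathbb K=K\langle\!\langle x_1,\dots,x_m\rangle\!\rangle$ be a field of iterated Laurent series over a field $K$ of characteristic $0$, let $\lambda$ be one of the variables $x_1,\dots,x_m$, and let $L\subset\mathbb K$ be the subfield of series not involving $\lambda$. Let $$F(\lambda)=\frac{P(\lambda)}{\prod_{1\le i\le n}(\lambda^{j_i}-z_i)},$$ where $P(\lambda)\in L[\lambda]$, the $j_i$ are nonnegative integers, $z_i\in L$ (with $z_i=0$ allowed), and all $\lambda^{j_i}-z_i\ne0$. Suppose that the factors $\lambda^{j_i}-z_i$ of the denominator are pairwise relatively prime in $L[\lambda]$ and that the partial fraction decomposition of $F$ is $$F=f(\lambda)+\sum_{1\le i\le n}\frac{p_i(\lambda)}{\lambda^{j_i}-z_i},$$ where $f(\lambda)\in L[\lambda]$ and each $p_i(\lambda)\in L[\lambda]$ has degree less than $j_i$. Then $$\mathop{\mathrm{PT}}_\lambda F=f(\lambda)+\sum_{i:\ z_i\prec\lambda^{j_i}}\frac{p_i(\lambda)}{\lambda^{j_i}-z_i}.$$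
   Context: $K\langle\!\langle x_1,\dots,x_m\rangle\!\rangle=K((x_1))((x_2))\cdots((x_m))$; its elements are exactly the formal series $\sum_{\mathbf n\in\mathbb{Z}^m}b_{\mathbf n}\mathbf x^{\mathbf n}$ over $K$ with support well-ordered in the reverse lexicographic ordering of $\mathbb{Z}^m$ ($\mathbf n<\mathbf k$ iff for some $i$, $n_i<k_i$ and $n_j=k_j$ for all $j>i$). The order of a nonzero element is the minimum of its support; $a\prec b$ means that the order of $a$ is smaller than the order of $b$, and $0$ is regarded as having order $+\infty$ (so $\lambda^j\prec0$ and never $0\prec\lambda^{j}$). $\mathrm{PT}_\lambda F$ is the sum of the terms of (the series expansion in $\mathbb K$ of) $F$ with nonnegative exponent of $\lambda$. A polynomial of degree less than $0$ is $0$. *)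

theory Defs
  imports "HOL-Computational_Algebra.Polynomial"
begin

section \<open>Well-ordered subsets of a linear order\<close>

lemma wfp_on_less_iff_ex_least:
  fixes S :: "'a::linorder set"
  shows "wfp_on S (<) \<longleftrightarrow> (\<forall>T\<subseteq>S. T \<noteq> {} \<longrightarrow> (\<exists>m\<in>T. \<forall>t\<in>T. m \<le> t))"
  unfolding wfp_on_iff_ex_minimal by (meson not_le)

lemma wfp_on_less_leastE:
  fixes S :: "'a::linorder set"
  assumes "wfp_on S (<)" "T \<subseteq> S" "T \<noteq> {}"
  obtains m where "m \<in> T" "\<And>t. t \<in> T \<Longrightarrow> m \<le> t"
  using assms unfolding wfp_on_less_iff_ex_least by metis

lemma wfp_on_less_Un:
  fixes S :: "'a::linorder set"
  assumes "wfp_on S (<)" "wfp_on T (<)"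
  shows "wfp_on (S \<union> T) (<)"
  unfolding wfp_on_less_iff_ex_least
proof (intro allI impI)
  fix U assume U: "U \<subseteq> S \<union> T" "U \<noteq> {}"
  show "\<exists>m\<in>U. \<forall>t\<in>U. m \<le> t"
  proof (cases "U \<inter> S = {} \<or> U \<inter> T = {}")
    case True
    then have "U \<subseteq> S \<or> U \<subseteq> T" using U by blast
    then show ?thesis using assms U unfolding wfp_on_less_iff_ex_least by blast
  next
    case False
    obtain a where a: "a \<in> U \<inter> S" "\<And>t. t \<in> U \<inter> S \<Longrightarrow> a \<le> t"
      using wfp_on_less_leastE[OF assms(1), of "U \<inter> S"] False by auto
    obtain b where b: "b \<in> U \<inter> T" "\<And>t. t \<in> U \<inter> T \<Longrightarrow> b \<le> t"
      using wfp_on_less_leastE[OF assms(2), of "U \<inter> T"] False by auto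
    have "min a b \<in> U" using a(1) b(1) by (auto simp: min_def)
    moreover have "min a b \<le> t" if "t \<in> U" for t
      using a(2)[of t] b(2)[of t] that U(1) by (meson IntI UnE min.coboundedI1 min.coboundedI2 subsetD)
    ultimately show ?thesis by blast
  qed
qed

lemma finite_if_wfp_on_less_greater:
  fixes A :: "'a::linorder set"
  assumes wf: "wfp_on A (<)" and max: "\<And>T. T \<subseteq> A \<Longrightarrow> T \<noteq> {} \<Longrightarrow> \<exists>m\<in>T. \<forall>t\<in>T. t \<le> m"
  shows "finite A"
proof -
  have fin: "finite {b\<in>A. b \<le> a}" if "a \<in> A" for a
  proof (induction rule: wfp_on_induct[OF wf that, consumes 0, case_names less])
    case (less a)
    show ?case
    proof (cases "{b\<in>A. b < a} = {}")
      case True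
      then have "{b\<in>A. b \<le> a} \<subseteq> {a}" by force
      then show ?thesis by (rule finite_subset) simp
    next
      case False
      then obtain c where c: "c \<in> {b\<in>A. b < a}" "\<And>t. t \<in> {b\<in>A. b < a} \<Longrightarrow> t \<le> c"
        using max[of "{b\<in>A. b < a}"] by blast
      have "{b\<in>A. b \<le> a} \<subseteq> insert a {b\<in>A. b \<le> c}" using c(2) by force
      moreover have "finite {b\<in>A. b \<le> c}" using less(2) c(1) by blast
      ultimately show ?thesis by (meson finite_insert finite_subset)
    qed
  qed
  show ?thesis
  proof (cases "A = {}")
    case False
    then obtain m where "m \<in> A" "\<And>t. t \<in> A \<Longrightarrow> t \<le> m" using max[of A] by blast
    then have "A = {b\<in>A. b \<le> m}" by blast
    then show ?thesis using fin[OF \<open>m \<in> A\<close>] by simp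
  qed simp
qed

definition sumset :: "'a::plus set \<Rightarrow> 'a set \<Rightarrow> 'a set" where
  "sumset A B = {a + b | a b. a \<in> A \<and> b \<in> B}"

lemma wfp_on_less_sumset:
  fixes A B :: "'a::linordered_ab_group_add set"
  assumes A: "wfp_on A (<)" and B: "wfp_on B (<)"
  shows "wfp_on (sumset A B) (<)"
proof -
  have step: "\<exists>a1\<in>A. \<exists>b1\<in>B. a1 + b1 \<in> T \<and>
      (\<forall>a\<in>A. \<forall>b\<in>B. a + b \<in> {t\<in>T. t < a1 + b1} \<longrightarrow> a < a1)"
    if "T \<subseteq> sumset A B" "T \<noteq> {}" for T
  proof -
    have "{b\<in>B. \<exists>a\<in>A. a + b \<in> T} \<noteq> {}" using that by (auto simp: sumset_def)
    then obtain b1 where b1: "b1 \<in> {b\<in>B. \<exists>a\<in>A. a + b \<in> T}"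
      "\<And>t. t \<in> {b\<in>B. \<exists>a\<in>A. a + b \<in> T} \<Longrightarrow> b1 \<le> t"
      using wfp_on_less_leastE[OF B, of "{b\<in>B. \<exists>a\<in>A. a + b \<in> T}"] by blast
    from b1(1) obtain a1 where a1: "a1 \<in> A" "a1 + b1 \<in> T" by blast
    have "a < a1" if "a \<in> A" "b \<in> B" "a + b \<in> T" "a + b < a1 + b1" for a b
    proof -
      have "b1 \<le> b" using b1(2) that by blast
      then show ?thesis using that(4) by (meson add_mono not_le)
    qed
    then show ?thesis using a1 b1(1) by blast
  qed
  have ind: "\<forall>T. T \<subseteq> sumset A B \<longrightarrow> T \<noteq> {} \<longrightarrow> (\<forall>a\<in>A. \<forall>b\<in>B. a + b \<in> T \<longrightarrow> a < a0)
      \<longrightarrow> (\<exists>m\<in>T. \<forall>t\<in>T. m \<le> t)" if "a0 \<in> A" for a0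
  proof (induction rule: wfp_on_induct[OF A that, consumes 0, case_names less])
    case (less a0)
    show ?case
    proof (intro allI impI)
    fix T assume prems: "T \<subseteq> sumset A B" "T \<noteq> {}"
      "\<forall>a\<in>A. \<forall>b\<in>B. a + b \<in> T \<longrightarrow> a < a0"
    obtain a1 b1 where ab: "a1 \<in> A" "b1 \<in> B" "a1 + b1 \<in> T"
      "\<forall>a\<in>A. \<forall>b\<in>B. a + b \<in> {t\<in>T. t < a1 + b1} \<longrightarrow> a < a1"
      using step[OF prems(1,2)] by blast
    show "\<exists>m\<in>T. \<forall>t\<in>T. m \<le> t"
    proof (cases "{t\<in>T. t < a1 + b1} = {}")
      case True
      then show ?thesis using ab(3) by (metis (mono_tags, lifting) empty_iff mem_Collect_eq not_le)
    next
      case False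
      have "a1 < a0" using ab prems by blast
      then obtain m where m: "m \<in> {t\<in>T. t < a1 + b1}" "\<forall>t\<in>{t\<in>T. t < a1 + b1}. m \<le> t"
        using less(2)[OF ab(1), rule_format, of "{t\<in>T. t < a1 + b1}"] ab(4) False prems(1) by blast
      have "m \<le> t" if "t \<in> T" for t
        using m that by (cases "t < a1 + b1") (auto simp: not_less)
      then show ?thesis using m(1) by blast
    qed
    qed
  qed
  show ?thesis
    unfolding wfp_on_less_iff_ex_least
  proof (intro allI impI)
    fix T assume T: "T \<subseteq> sumset A B" "T \<noteq> {}"
    obtain a1 b1 where ab: "a1 \<in> A" "b1 \<in> B" "a1 + b1 \<in> T"
      "\<forall>a\<in>A. \<forall>b\<in>B. a + b \<in> {t\<in>T. t < a1 + b1} \<longrightarrow> a < a1"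
      using step[OF T] by blast
    show "\<exists>m\<in>T. \<forall>t\<in>T. m \<le> t"
    proof (cases "{t\<in>T. t < a1 + b1} = {}")
      case True
      then show ?thesis using ab(3) by (metis (mono_tags, lifting) empty_iff mem_Collect_eq not_le)
    next
      case False
      then obtain m where m: "m \<in> {t\<in>T. t < a1 + b1}" "\<forall>t\<in>{t\<in>T. t < a1 + b1}. m \<le> t"
        using ind[OF ab(1), rule_format, of "{t\<in>T. t < a1 + b1}"] ab(4) T(1) by blast
      have "m \<le> t" if "t \<in> T" for t
        using m that by (cases "t < a1 + b1") (auto simp: not_less)
      then show ?thesis using m(1) by blast
    qed
  qed
qed

definition sum_pairs :: "'a::plus set \<Rightarrow> 'a set \<Rightarrow> 'a \<Rightarrow> ('a \<times> 'a) set" where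
  "sum_pairs A B n = {(a, b). a \<in> A \<and> b \<in> B \<and> a + b = n}"

lemma finite_sum_pairs:
  fixes A B :: "'a::linordered_ab_group_add set"
  assumes A: "wfp_on A (<)" and B: "wfp_on B (<)"
  shows "finite (sum_pairs A B n)"
proof -
  let ?S = "{a\<in>A. n - a \<in> B}"
  have "finite ?S"
  proof (rule finite_if_wfp_on_less_greater)
    show "wfp_on ?S (<)" using A by (rule wfp_on_subset) blast
  next
    fix T assume T: "T \<subseteq> ?S" "T \<noteq> {}"
    then have "(\<lambda>a. n - a) ` T \<subseteq> B" "(\<lambda>a. n - a) ` T \<noteq> {}" by auto
    then obtain m where m: "m \<in> (\<lambda>a. n - a) ` T" "\<And>t. t \<in> (\<lambda>a. n - a) ` T \<Longrightarrow> m \<le> t"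
      using wfp_on_less_leastE[OF B] by blast
    then show "\<exists>m\<in>T. \<forall>t\<in>T. t \<le> m" by fastforce
  qed
  moreover have "sum_pairs A B n \<subseteq> (\<lambda>a. (a, n - a)) ` ?S"
    by (auto simp: sum_pairs_def image_iff algebra_simps)
  ultimately show ?thesis by (meson finite_imageI finite_subset)
qed

inductive_set add_closure :: "'a::monoid_add set \<Rightarrow> 'a set" for S where
  zero: "0 \<in> add_closure S"
| add: "s \<in> S \<Longrightarrow> t \<in> add_closure S \<Longrightarrow> s + t \<in> add_closure S"

lemma wfp_on_less_add_closure:
  fixes S :: "'a::linordered_ab_group_add set"
  assumes S: "wfp_on S (<)" and pos: "\<And>s. s \<in> S \<Longrightarrow> 0 < s"
  shows "wfp_on (add_closure S) (<)"
proof -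
  let ?M = "add_closure S"
  define W where "W = {x \<in> ?M. wfp_on {y\<in>?M. y \<le> x} (<)}"
  define B where "B = ?M - W"
  have down: "y \<in> W" if "x \<in> W" "y \<in> ?M" "y \<le> x" for x y
  proof -
    have "{z\<in>?M. z \<le> y} \<subseteq> {z\<in>?M. z \<le> x}" using that by auto
    then show ?thesis using that unfolding W_def by (auto intro: wfp_on_subset)
  qed
  have W: "wfp_on W (<)"
    unfolding wfp_on_less_iff_ex_least
  proof (intro allI impI)
    fix U assume U: "U \<subseteq> W" "U \<noteq> {}"
    then obtain u where u: "u \<in> U" by blast
    then have wf: "wfp_on {y\<in>?M. y \<le> u} (<)" using U unfolding W_def by blast
    have "{y\<in>U. y \<le> u} \<subseteq> {y\<in>?M. y \<le> u}" "{y\<in>U. y \<le> u} \<noteq> {}"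
      using U u unfolding W_def by auto
    then obtain m where m: "m \<in> {y\<in>U. y \<le> u}" "\<And>t. t \<in> {y\<in>U. y \<le> u} \<Longrightarrow> m \<le> t"
      by (rule wfp_on_less_leastE[OF wf]) blast
    have "m \<le> t" if "t \<in> U" for t
      using m that by (cases "t \<le> u") auto
    then show "\<exists>m\<in>U. \<forall>t\<in>U. m \<le> t" using m(1) by blast
  qed
  have sing: "wfp_on {x} (<)" for x :: 'a
    unfolding wfp_on_less_iff_ex_least by auto
  have noB: "\<exists>t\<in>B. t < m" if m: "m \<in> B" for m
  proof (rule ccontr)
    assume "\<not> (\<exists>t\<in>B. t < m)"
    then have "{y\<in>?M. y \<le> m} \<subseteq> W \<union> {m}" unfolding B_def by force
    then have "wfp_on {y\<in>?M. y \<le> m} (<)"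
      by (rule wfp_on_subset[OF wfp_on_less_Un[OF W sing]])
    then show False using m unfolding B_def W_def by blast
  qed
  have nonneg: "0 \<le> x" if "x \<in> ?M" for x
    using that by induction (use pos in \<open>auto intro: add_nonneg_nonneg less_imp_le\<close>)
  have low: "b \<in> B \<longrightarrow> (\<exists>d \<in> B \<inter> sumset S W. d \<le> b)" if "b \<in> ?M" for b
    using that
  proof induction
    case zero
    show ?case using noB[of 0] nonneg unfolding B_def by force
  next
    case (add s t)
    show ?case
    proof
      assume B: "s + t \<in> B"
      show "\<exists>d \<in> B \<inter> sumset S W. d \<le> s + t"
      proof (cases "t \<in> B")
        case True
        then obtain d where "d \<in> B \<inter> sumset S W" "d \<le> t" using add.IH by blast
        moreover have "t \<le> s + t" using pos[OF add.hyps(1)] by simp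
        ultimately show ?thesis by (meson order_trans)
      next
        case False
        then have "s + t \<in> sumset S W" using add.hyps unfolding B_def sumset_def by blast
        then show ?thesis using B by blast
      qed
    qed
  qed
  have "B = {}"
  proof (rule ccontr)
    assume "B \<noteq> {}"
    then have "B \<inter> sumset S W \<noteq> {}" using low unfolding B_def by blast
    then obtain m where m: "m \<in> B \<inter> sumset S W" "\<And>t. t \<in> B \<inter> sumset S W \<Longrightarrow> m \<le> t"
      using wfp_on_less_leastE[OF wfp_on_less_sumset[OF S W], of "B \<inter> sumset S W"] by blast
    then obtain t where t: "t \<in> B" "t < m" using noB by blast
    then obtain d where "d \<in> B \<inter> sumset S W" "d \<le> t" using low unfolding B_def by blast
    then show False using m(2) t(2) by (meson leD order_trans)
  qed
  then have "?M \<subseteq> W" unfolding B_def by blast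
  then show ?thesis by (rule wfp_on_subset[OF W])
qed


section \<open>Hahn series\<close>

typedef (overloaded) ('g, 'k) hahn =
  "{f :: 'g::linorder \<Rightarrow> 'k::zero. wfp_on {n. f n \<noteq> 0} (<)}"
  morphisms hahn_coeff Abs_hahn
  by (rule exI[of _ "\<lambda>_. 0"]) (simp add: wfp_on_less_iff_ex_least)

setup_lifting type_definition_hahn

definition hahn_supp :: "('g::linorder, 'k::zero) hahn \<Rightarrow> 'g set" where
  "hahn_supp f = {n. hahn_coeff f n \<noteq> 0}"

lemma wfp_on_hahn_supp: "wfp_on (hahn_supp f) (<)"
  using hahn_coeff[of f] by (simp add: hahn_supp_def)

lemma hahn_eqI: "(\<And>n. hahn_coeff f n = hahn_coeff g n) \<Longrightarrow> f = g"
  by (simp add: hahn_coeff_inject[symmetric] fun_eq_iff)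

lemma hahn_coeff_Abs:
  assumes "wfp_on S (<)" "{n. f n \<noteq> 0} \<subseteq> S"
  shows "hahn_coeff (Abs_hahn f) = f"
  using wfp_on_subset[OF assms] by (simp add: Abs_hahn_inverse)

instantiation hahn :: (linorder, zero) zero
begin
lift_definition zero_hahn :: "('a, 'b) hahn" is "\<lambda>_. 0"
  by (simp add: wfp_on_less_iff_ex_least)
instance ..
end

instantiation hahn :: (linorder, ab_group_add) ab_group_add
begin

lift_definition plus_hahn :: "('a, 'b) hahn \<Rightarrow> ('a, 'b) hahn \<Rightarrow> ('a, 'b) hahn"
  is "\<lambda>f g n. f n + g n"
proof -
  fix f g :: "'a \<Rightarrow> 'b"
  assume *: "wfp_on {n. f n \<noteq> 0} (<)" "wfp_on {n. g n \<noteq> 0} (<)"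
  show "wfp_on {n. f n + g n \<noteq> 0} (<)"
    by (rule wfp_on_subset[OF wfp_on_less_Un[OF *]]) auto
qed

lift_definition uminus_hahn :: "('a, 'b) hahn \<Rightarrow> ('a, 'b) hahn" is "\<lambda>f n. - f n"
  by simp

lift_definition minus_hahn :: "('a, 'b) hahn \<Rightarrow> ('a, 'b) hahn \<Rightarrow> ('a, 'b) hahn"
  is "\<lambda>f g n. f n - g n"
proof -
  fix f g :: "'a \<Rightarrow> 'b"
  assume *: "wfp_on {n. f n \<noteq> 0} (<)" "wfp_on {n. g n \<noteq> 0} (<)"
  show "wfp_on {n. f n - g n \<noteq> 0} (<)"
    by (rule wfp_on_subset[OF wfp_on_less_Un[OF *]]) auto
qed

instance
  by standard (transfer; simp add: algebra_simps)+

end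

lift_definition hahn_monom :: "'g::linorder \<Rightarrow> 'k::zero \<Rightarrow> ('g, 'k) hahn"
  is "\<lambda>n c k. if k = n then c else 0"
  by (auto simp: wfp_on_less_iff_ex_least)

instantiation hahn :: (linordered_ab_group_add, comm_ring_1) comm_ring_1
begin

definition one_hahn :: "('a, 'b) hahn" where "one_hahn = hahn_monom 0 1"

lift_definition times_hahn :: "('a, 'b) hahn \<Rightarrow> ('a, 'b) hahn \<Rightarrow> ('a, 'b) hahn"
  is "\<lambda>f g n. \<Sum>(a, b) \<in> {(a, b). f a \<noteq> 0 \<and> g b \<noteq> 0 \<and> a + b = n}. f a * g b"
proof -
  fix f g :: "'a \<Rightarrow> 'b"
  assume *: "wfp_on {n. f n \<noteq> 0} (<)" "wfp_on {n. g n \<noteq> 0} (<)"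
  let ?h = "\<lambda>n. \<Sum>(a, b) \<in> {(a, b). f a \<noteq> 0 \<and> g b \<noteq> 0 \<and> a + b = n}. f a * g b"
  have "{n. ?h n \<noteq> 0} \<subseteq> sumset {n. f n \<noteq> 0} {n. g n \<noteq> 0}"
  proof
    fix n assume "n \<in> {n. ?h n \<noteq> 0}"
    then obtain p where "p \<in> {(a, b). f a \<noteq> 0 \<and> g b \<noteq> 0 \<and> a + b = n}"
      using sum.not_neutral_contains_not_neutral by blast
    then show "n \<in> sumset {n. f n \<noteq> 0} {n. g n \<noteq> 0}" by (auto simp: sumset_def)
  qed
  then show "wfp_on {n. ?h n \<noteq> 0} (<)"
    by (rule wfp_on_subset[OF wfp_on_less_sumset[OF *]])
qed

lemma hahn_coeff_mult:
  assumes A: "wfp_on A (<)" and B: "wfp_on B (<)" and "hahn_supp f \<subseteq> A" "hahn_supp g \<subseteq> B"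
  shows "hahn_coeff (f * g) n = (\<Sum>(a, b) \<in> sum_pairs A B n. hahn_coeff f a * hahn_coeff g b)"
proof -
  have "hahn_coeff (f * g) n =
    (\<Sum>(a, b) \<in> {(a, b). hahn_coeff f a \<noteq> 0 \<and> hahn_coeff g b \<noteq> 0 \<and> a + b = n}.
      hahn_coeff f a * hahn_coeff g b)"
    by transfer simp
  also have "\<dots> = (\<Sum>(a, b) \<in> sum_pairs A B n. hahn_coeff f a * hahn_coeff g b)"
    using assms(3,4)
    by (intro sum.mono_neutral_left finite_sum_pairs[OF A B])
      (auto simp: sum_pairs_def hahn_supp_def)
  finally show ?thesis .
qed

lemma hahn_supp_mult: "hahn_supp (f * g) \<subseteq> sumset (hahn_supp f) (hahn_supp g)"
  for f g :: "('a, 'b) hahn"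
proof
  fix n assume "n \<in> hahn_supp (f * g)"
  then have "(\<Sum>(a, b) \<in> sum_pairs (hahn_supp f) (hahn_supp g) n.
      hahn_coeff f a * hahn_coeff g b) \<noteq> 0"
    using hahn_coeff_mult[OF wfp_on_hahn_supp wfp_on_hahn_supp order_refl order_refl, of f g n]
    by (simp add: hahn_supp_def)
  then obtain p where "p \<in> sum_pairs (hahn_supp f) (hahn_supp g) n"
    using sum.not_neutral_contains_not_neutral by blast
  then show "n \<in> sumset (hahn_supp f) (hahn_supp g)"
    by (auto simp: sumset_def sum_pairs_def)
qed

lemma hahn_coeff_monom_mult:
  "hahn_coeff (hahn_monom a c * f) n = c * hahn_coeff f (n - a)" for f :: "('a, 'b) hahn"
proof -
  have wa: "wfp_on {a} (<)" by (auto simp: wfp_on_less_iff_ex_least)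
  have wb: "wfp_on (insert (n - a) (hahn_supp f)) (<)"
    using wfp_on_less_Un[OF _ wfp_on_hahn_supp, of "{n - a}" f]
    by (auto simp: wfp_on_less_iff_ex_least)
  have "sum_pairs {a} (insert (n - a) (hahn_supp f)) n = {(a, n - a)}"
    by (auto simp: sum_pairs_def)
  moreover have "hahn_supp (hahn_monom a c) \<subseteq> {a}"
    by (auto simp: hahn_supp_def hahn_monom.rep_eq)
  ultimately show ?thesis
    using hahn_coeff_mult[OF wa wb, of "hahn_monom a c" f n]
    by (simp add: subset_insertI hahn_monom.rep_eq)
qed

instance
proof
  fix f g h :: "('a, 'b) hahn"
  let ?F = "hahn_supp f" and ?G = "hahn_supp g" and ?H = "hahn_supp h"
  note wf = wfp_on_hahn_supp
  note wf2 = wfp_on_less_sumset[OF wf wf]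
  show "f * g * h = f * (g * h)"
  proof (rule hahn_eqI)
    fix n
    let ?c = "\<lambda>a b c. hahn_coeff f a * hahn_coeff g b * hahn_coeff h c"
    have "hahn_coeff (f * g * h) n =
      (\<Sum>(p, c) \<in> sum_pairs (sumset ?F ?G) ?H n. hahn_coeff (f * g) p * hahn_coeff h c)"
      by (rule hahn_coeff_mult[OF wf2 wf hahn_supp_mult order_refl])
    also have "\<dots> = (\<Sum>(p, c) \<in> sum_pairs (sumset ?F ?G) ?H n.
        \<Sum>(a, b) \<in> sum_pairs ?F ?G p. ?c a b c)"
      by (simp add: hahn_coeff_mult[OF wf wf order_refl order_refl] sum_distrib_right case_prod_unfold)
    also have "\<dots> = (\<Sum>x \<in> sum_pairs (sumset ?F ?G) ?H n.
        \<Sum>y \<in> sum_pairs ?F ?G (fst x). ?c (fst y) (snd y) (snd x))"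
      by (simp add: case_prod_unfold)
    also have "\<dots> = (\<Sum>(x, y) \<in> Sigma (sum_pairs (sumset ?F ?G) ?H n) (\<lambda>x. sum_pairs ?F ?G (fst x)).
        ?c (fst y) (snd y) (snd x))"
      by (rule sum.Sigma) (auto intro: finite_sum_pairs wf wf2)
    also have "\<dots> = (\<Sum>(a, b, c) \<in> {(a, b, c). a \<in> ?F \<and> b \<in> ?G \<and> c \<in> ?H \<and> a + b + c = n}. ?c a b c)"
      by (rule sum.reindex_bij_witness[where
            i = "\<lambda>(a, b, c). ((a + b, c), (a, b))" and j = "\<lambda>((p, c), (a, b)). (a, b, c)"])
        (auto simp: sum_pairs_def sumset_def)
    finally have 1: "hahn_coeff (f * g * h) n =
      (\<Sum>(a, b, c) \<in> {(a, b, c). a \<in> ?F \<and> b \<in> ?G \<and> c \<in> ?H \<and> a + b + c = n}. ?c a b c)" .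
    have "hahn_coeff (f * (g * h)) n =
      (\<Sum>(a, p) \<in> sum_pairs ?F (sumset ?G ?H) n. hahn_coeff f a * hahn_coeff (g * h) p)"
      by (rule hahn_coeff_mult[OF wf wf2 order_refl hahn_supp_mult])
    also have "\<dots> = (\<Sum>(a, p) \<in> sum_pairs ?F (sumset ?G ?H) n.
        \<Sum>(b, c) \<in> sum_pairs ?G ?H p. ?c a b c)"
      by (simp add: hahn_coeff_mult[OF wf wf order_refl order_refl] sum_distrib_left case_prod_unfold
          mult.assoc)
    also have "\<dots> = (\<Sum>x \<in> sum_pairs ?F (sumset ?G ?H) n.
        \<Sum>y \<in> sum_pairs ?G ?H (snd x). ?c (fst x) (fst y) (snd y))"
      by (simp add: case_prod_unfold)
    also have "\<dots> = (\<Sum>(x, y) \<in> Sigma (sum_pairs ?F (sumset ?G ?H) n) (\<lambda>x. sum_pairs ?G ?H (snd x)).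
        ?c (fst x) (fst y) (snd y))"
      by (rule sum.Sigma) (auto intro: finite_sum_pairs wf wf2)
    also have "\<dots> = (\<Sum>(a, b, c) \<in> {(a, b, c). a \<in> ?F \<and> b \<in> ?G \<and> c \<in> ?H \<and> a + b + c = n}. ?c a b c)"
      by (rule sum.reindex_bij_witness[where
            i = "\<lambda>(a, b, c). ((a, b + c), (b, c))" and j = "\<lambda>((a, p), (b, c)). (a, b, c)"])
        (auto simp: sum_pairs_def sumset_def add.assoc)
    finally show "hahn_coeff (f * g * h) n = hahn_coeff (f * (g * h)) n" using 1 by simp
  qed
  show "f * g = g * f"
  proof (rule hahn_eqI)
    fix n
    show "hahn_coeff (f * g) n = hahn_coeff (g * f) n"
      unfolding hahn_coeff_mult[OF wf wf order_refl order_refl]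
      by (rule sum.reindex_bij_witness[where i = prod.swap and j = prod.swap])
        (auto simp: sum_pairs_def add.commute mult.commute)
  qed
  show "1 * f = f"
    by (rule hahn_eqI) (simp add: one_hahn_def hahn_coeff_monom_mult)
  show "(f + g) * h = f * h + g * h"
  proof (rule hahn_eqI)
    fix n
    have u: "wfp_on (?F \<union> ?G) (<)" by (rule wfp_on_less_Un[OF wf wf])
    have "hahn_supp (f + g) \<subseteq> ?F \<union> ?G" by (auto simp: hahn_supp_def plus_hahn.rep_eq)
    note * = hahn_coeff_mult[OF u wf[of h] this order_refl, of n]
      hahn_coeff_mult[OF u wf[of h] Un_upper1 order_refl, of n]
      hahn_coeff_mult[OF u wf[of h] Un_upper2 order_refl, of n]
    show "hahn_coeff ((f + g) * h) n = hahn_coeff (f * h + g * h) n"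
      by (simp add: plus_hahn.rep_eq * distrib_right sum.distrib case_prod_unfold)
  qed
  show "(0 :: ('a, 'b) hahn) \<noteq> 1"
  proof
    assume "(0 :: ('a, 'b) hahn) = 1"
    then have "hahn_coeff (0 :: ('a, 'b) hahn) 0 = hahn_coeff 1 0" by simp
    then show False by (simp add: one_hahn_def hahn_monom.rep_eq zero_hahn.rep_eq)
  qed
qed

end

lemma hahn_geometric:
  fixes g :: "('g::linordered_ab_group_add, 'k::comm_ring_1) hahn"
  assumes pos: "\<And>n. n \<in> hahn_supp g \<Longrightarrow> 0 < n"
  shows "\<exists>h. (1 - g) * h = 1"
proof -
  let ?S = "hahn_supp g" and ?M = "add_closure (hahn_supp g)"
  let ?R = "{(y, x). y \<in> ?M \<and> x \<in> ?M \<and> y < x}"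
  note wS = wfp_on_hahn_supp[of g]
  have wM: "wfp_on ?M (<)" by (rule wfp_on_less_add_closure[OF wS pos])
  have R: "wf ?R"
  proof -
    have "?R = {(x, y). x < y \<and> x \<in> ?M \<and> y \<in> ?M}" by blast
    then show ?thesis using iffD1[OF wfp_on_iff_wfp wM] by (simp add: wfp_def)
  qed
  define Phi where "Phi h n = (if n \<in> ?M then (if n = 0 then 1 else 0) +
    (\<Sum>(s, m) \<in> sum_pairs ?S ?M n. hahn_coeff g s * h m) else 0)" for h n
  define h where "h = wfrec ?R Phi"
  have adm: "adm_wf ?R Phi"
    unfolding adm_wf_def Phi_def
  proof (intro allI impI)
    fix h1 h2 :: "'g \<Rightarrow> 'k" and x assume eq: "\<forall>z. (z, x) \<in> ?R \<longrightarrow> h1 z = h2 z"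
    have "h1 m = h2 m" if "x \<in> ?M" "(s, m) \<in> sum_pairs ?S ?M x" for s m
      using eq that pos[of s] by (auto simp: sum_pairs_def)
    then show "(if x \<in> ?M then (if x = 0 then 1 else 0) +
        (\<Sum>(s, m) \<in> sum_pairs ?S ?M x. hahn_coeff g s * h1 m) else 0) =
      (if x \<in> ?M then (if x = 0 then 1 else 0) +
        (\<Sum>(s, m) \<in> sum_pairs ?S ?M x. hahn_coeff g s * h2 m) else 0)"
      by (auto intro!: sum.cong)
  qed
  have h: "h n = Phi h n" for n
    using wfrec_fixpoint[OF R adm] unfolding h_def by metis
  have supp: "{n. h n \<noteq> 0} \<subseteq> ?M" 
  proof
    fix n assume "n \<in> {n. h n \<noteq> 0}"
    then have "Phi h n \<noteq> 0" using h[of n] by simp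
    then show "n \<in> ?M" by (simp add: Phi_def split: if_splits)
  qed
  define H where "H = Abs_hahn h"
  have coeff: "hahn_coeff H = h" unfolding H_def by (rule hahn_coeff_Abs[OF wM supp])
  have "H = 1 + g * H"
  proof (rule hahn_eqI)
    fix n
    have gH: "hahn_coeff (g * H) n = (\<Sum>(s, m) \<in> sum_pairs ?S ?M n. hahn_coeff g s * h m)"
      using hahn_coeff_mult[OF wS wM order_refl, of H n] supp by (simp add: hahn_supp_def coeff)
    have "sum_pairs ?S ?M n = {}" if "n \<notin> ?M"
      using that by (auto simp: sum_pairs_def intro: add_closure.add)
    then have "h n = (if n = 0 then 1 else 0) + hahn_coeff (g * H) n"
      using h[of n] add_closure.zero[of ?S] unfolding gH Phi_def by (auto split: if_splits)
    then show "hahn_coeff H n = hahn_coeff (1 + g * H) n"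
      by (simp add: coeff plus_hahn.rep_eq one_hahn_def hahn_monom.rep_eq)
  qed
  then have "(1 - g) * H = 1" by (simp add: algebra_simps)
  then show ?thesis by blast
qed

lemma hahn_inverse_exists:
  fixes f :: "('g::linordered_ab_group_add, 'k::field) hahn"
  assumes "f \<noteq> 0"
  shows "\<exists>h. f * h = 1"
proof -
  have "hahn_supp f \<noteq> {}"
    using assms hahn_eqI[of f 0] by (auto simp: hahn_supp_def zero_hahn.rep_eq)
  then obtain d where d: "d \<in> hahn_supp f" "\<And>n. n \<in> hahn_supp f \<Longrightarrow> d \<le> n"
    by (rule wfp_on_less_leastE[OF wfp_on_hahn_supp order_refl]) blast
  define c where "c = hahn_coeff f d"
  have c: "c \<noteq> 0" using d(1) by (simp add: c_def hahn_supp_def)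
  define u where "u = hahn_monom (- d) (1 / c)"
  define g where "g = 1 - u * f"
  have "0 < n" if "n \<in> hahn_supp g" for n
  proof -
    have *: "(if n = 0 then 1 else 0) - hahn_coeff f (n + d) / c \<noteq> 0"
      using that by (simp add: hahn_supp_def g_def u_def minus_hahn.rep_eq one_hahn_def
          hahn_monom.rep_eq hahn_coeff_monom_mult)
    then have n: "n \<noteq> 0" using c by (auto simp: c_def)
    then have "n + d \<in> hahn_supp f" using * by (auto simp: hahn_supp_def)
    then have "0 \<le> n" using d(2)[of "n + d"] by simp
    then show ?thesis using n by simp
  qed
  then obtain h where "(1 - g) * h = 1" using hahn_geometric by blast
  then have "f * (u * h) = 1" by (simp add: g_def ac_simps)
  then show ?thesis by blast
qed

instantiation hahn :: (linordered_ab_group_add, field) inverse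
begin

definition "inverse f = (if f = 0 then 0 else (SOME h. f * h = 1))" for f :: "('a, 'b) hahn"

definition "f div g = f * inverse g" for f g :: "('a, 'b) hahn"

instance ..

end

instance hahn :: (linordered_ab_group_add, field) field
proof
  fix f g :: "('a, 'b) hahn"
  show "f / g = f * inverse g" by (fact divide_hahn_def)
  show "inverse (0 :: ('a, 'b) hahn) = 0" by (simp add: inverse_hahn_def)
  assume "f \<noteq> 0"
  then show "inverse f * f = 1"
    using someI_ex[OF hahn_inverse_exists[of f]] by (simp add: inverse_hahn_def mult.commute)
qed

definition hahn_ord :: "('g::linorder, 'k::zero) hahn \<Rightarrow> 'g" where
  "hahn_ord f = (LEAST n. hahn_coeff f n \<noteq> 0)"

definition hahn_prec :: "('g::linorder, 'k::zero) hahn \<Rightarrow> ('g, 'k) hahn \<Rightarrow> bool"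
    (infix "\<prec>" 50) where
  "f \<prec> g \<longleftrightarrow> f \<noteq> 0 \<and> (g = 0 \<or> hahn_ord f < hahn_ord g)"


section \<open>Exponent vectors in reverse lexicographic order\<close>

typedef 'n expvec = "UNIV :: ('n \<Rightarrow> int) set"
  morphisms expo Expvec
  by simp

setup_lifting type_definition_expvec

lemma expvec_eqI: "(\<And>i. expo x i = expo y i) \<Longrightarrow> x = y"
  by (simp add: expo_inject[symmetric] fun_eq_iff)

instantiation expvec :: (type) ab_group_add
begin

lift_definition zero_expvec :: "'a expvec" is "\<lambda>_. 0" .
lift_definition plus_expvec :: "'a expvec \<Rightarrow> 'a expvec \<Rightarrow> 'a expvec" is "\<lambda>x y i. x i + y i" .
lift_definition uminus_expvec :: "'a expvec \<Rightarrow> 'a expvec" is "\<lambda>x i. - x i" .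
lift_definition minus_expvec :: "'a expvec \<Rightarrow> 'a expvec \<Rightarrow> 'a expvec" is "\<lambda>x y i. x i - y i" .

instance by standard (transfer; simp add: algebra_simps)+

end

instantiation expvec :: ("{finite, linorder}") linorder
begin

definition "x < y \<longleftrightarrow> (\<exists>i. expo x i < expo y i \<and> (\<forall>j>i. expo x j = expo y j))"
  for x y :: "'a expvec"

definition "x \<le> y \<longleftrightarrow> x < y \<or> x = y" for x y :: "'a expvec"

instance
proof
  fix x y z :: "'a expvec"
  have irrefl: "\<not> x < x" for x :: "'a expvec" by (simp add: less_expvec_def)
  have trans: "x < z" if xy: "x < y" and yz: "y < z" for x y z :: "'a expvec"
  proof -
    obtain i where i: "expo x i < expo y i" "\<forall>j>i. expo x j = expo y j"
      using xy unfolding less_expvec_def by blast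
    obtain k where k: "expo y k < expo z k" "\<forall>j>k. expo y j = expo z j"
      using yz unfolding less_expvec_def by blast
    have "expo x (max i k) < expo z (max i k) \<and> (\<forall>j>max i k. expo x j = expo z j)"
      using i k by (cases i k rule: linorder_cases) (auto simp: max_def)
    then show ?thesis unfolding less_expvec_def by blast
  qed
  show "(x < y) = (x \<le> y \<and> \<not> y \<le> x)"
    using irrefl[of x] irrefl[of y] trans unfolding less_eq_expvec_def by metis
  show "x \<le> x" by (simp add: less_eq_expvec_def)
  show "x \<le> y \<Longrightarrow> y \<le> z \<Longrightarrow> x \<le> z"
    using trans unfolding less_eq_expvec_def by blast
  show "x \<le> y \<Longrightarrow> y \<le> x \<Longrightarrow> x = y"
    using irrefl[of x] irrefl[of y] trans unfolding less_eq_expvec_def by metis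
  show "x \<le> y \<or> y \<le> x"
  proof (cases "x = y")
    case False
    let ?D = "{i. expo x i \<noteq> expo y i}"
    have "?D \<noteq> {}" using False expvec_eqI[of x y] by blast
    then have "Max ?D \<in> ?D" by (intro Max_in) simp_all
    moreover have "expo x j = expo y j" if "j > Max ?D" for j
      using Max_ge[of ?D j] that by (metis (mono_tags) finite leD mem_Collect_eq)
    ultimately obtain i where "expo x i \<noteq> expo y i" "\<forall>j>i. expo x j = expo y j" by blast
    then show ?thesis
      unfolding less_eq_expvec_def less_expvec_def by (metis linorder_neqE)
  qed (simp add: less_eq_expvec_def)
qed

end

instance expvec :: ("{finite, linorder}") linordered_ab_group_add
proof
  fix x y z :: "'a expvec"
  show "x \<le> y \<Longrightarrow> z + x \<le> z + y"
    unfolding less_eq_expvec_def less_expvec_def by (auto simp: plus_expvec.rep_eq)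
qed

lift_definition unit_expvec :: "'n \<Rightarrow> 'n expvec" is "\<lambda>v i. if i = v then 1 else 0" .


section \<open>Iterated Laurent series\<close>

text \<open>\<open>K((x\<^sub>1))\<dots>((x\<^sub>m))\<close> is realised as the field of all series over \<open>K\<close> whose support
  is well-ordered in reverse lexicographic order.  The variables are indexed by a finite linearly ordered type \<open>'n\<close>, so that \<open>m = CARD('n)\<close>
  and the coefficient of \<open>\<Prod>i. x\<^sub>i powi n i\<close> is \<open>hahn_coeff F (Expvec n)\<close>.\<close>

type_synonym ('k, 'n) iterated_laurent = "('n expvec, 'k) hahn"

definition ils_var :: "'n::{finite,linorder} \<Rightarrow> ('k::field, 'n) iterated_laurent" where
  "ils_var v = hahn_monom (unit_expvec v) 1"

definition ils_without :: "'n::{finite,linorder} \<Rightarrow> ('k::field, 'n) iterated_laurent set" where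
  "ils_without v = {F. \<forall>n. hahn_coeff F n \<noteq> 0 \<longrightarrow> expo n v = 0}"

lift_definition ils_PT :: "'n::{finite,linorder} \<Rightarrow>
    ('k::field, 'n) iterated_laurent \<Rightarrow> ('k, 'n) iterated_laurent"
  is "\<lambda>v F n. if expo n v \<ge> 0 then F n else 0"
  by (rule wfp_on_subset) auto


section \<open>Polynomials with coefficients in a subring\<close>

definition polys_over :: "'a::comm_ring_1 set \<Rightarrow> 'a poly set" where
  "polys_over L = {p. \<forall>i. coeff p i \<in> L}"

definition dvd_over :: "'a::comm_ring_1 set \<Rightarrow> 'a poly \<Rightarrow> 'a poly \<Rightarrow> bool" where
  "dvd_over L p q \<longleftrightarrow> (\<exists>r\<in>polys_over L. q = p * r)"

definition coprime_over :: "'a::comm_ring_1 set \<Rightarrow> 'a poly \<Rightarrow> 'a poly \<Rightarrow> bool" where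
  "coprime_over L p q \<longleftrightarrow>
    (\<forall>d\<in>polys_over L. dvd_over L d p \<longrightarrow> dvd_over L d q \<longrightarrow> dvd_over L d 1)"

end

theory Submission
  imports Defs
begin

text \<open>Write \<open>h = p / (\<lambda>^j - z)\<close>, so that \<open>(\<lambda>^j - z) * h = p\<close>, and let \<open>d\<close> be the order of
  \<open>\<lambda>^j - z\<close>.  If \<open>z \<prec> \<lambda>^j\<close>, then \<open>d\<close> is the order of \<open>z\<close> and does not involve \<open>\<lambda>\<close>; the least
  \<open>n\<close> in the support of \<open>h\<close> with negative \<open>\<lambda>\<close>-exponent would make \<open>d + n\<close> a term of \<open>p\<close>, because it
  cannot be cancelled.  Otherwise \<open>d\<close> is the order of \<open>\<lambda>^j\<close>, and the least \<open>n\<close> in the support of \<open>h\<close>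
  with nonnegative \<open>\<lambda>\<close>-exponent would give \<open>p\<close> a term of degree at least \<open>j\<close>.  So every summand of
  the decomposition is either kept or annihilated by \<open>PT\<close>.\<close>

text \<open>Choose \<open>n\<close> least among the support elements of \<open>h\<close> satisfying
  \<open>Q\<close>. If \<open>a + b = d + n\<close> with \<open>a\<close>, \<open>b\<close> in the
  supports, the shift hypothesis gives \<open>Q b\<close>, so \<open>d \<le> a\<close> and
  \<open>n \<le> b\<close>, hence \<open>(a, b) = (d, n)\<close>: the coefficient at
  \<open>d + n\<close> is a single nonzero product. \<open>Q\<close> stands for a sign condition on
  the exponent of the chosen variable, so one argument serves both cases below.\<close>

lemma hahn_coeff_mult_no_cancel:
  fixes G h :: "('g::linordered_ab_group_add, 'k::field) hahn"
  assumes d: "hahn_coeff G d \<noteq> 0" "\<And>a. hahn_coeff G a \<noteq> 0 \<Longrightarrow> d \<le> a"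
    and Q: "\<And>a b n. hahn_coeff G a \<noteq> 0 \<Longrightarrow> Q n \<Longrightarrow> a + b = d + n \<Longrightarrow> Q b"
    and m: "hahn_coeff h m \<noteq> 0" "Q m"
  shows "\<exists>n. Q n \<and> hahn_coeff (G * h) (d + n) \<noteq> 0"
proof -
  have "{b \<in> hahn_supp h. Q b} \<subseteq> hahn_supp h" "{b \<in> hahn_supp h. Q b} \<noteq> {}"
    using m by (auto simp: hahn_supp_def)
  then obtain n where n: "n \<in> hahn_supp h" "Q n" "\<And>b. b \<in> hahn_supp h \<Longrightarrow> Q b \<Longrightarrow> n \<le> b"
    using wfp_on_less_leastE[OF wfp_on_hahn_supp] by (metis (no_types, lifting) mem_Collect_eq)
  have "(a, b) = (d, n)" if "(a, b) \<in> sum_pairs (hahn_supp G) (hahn_supp h) (d + n)" for a b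
  proof -
    have ab: "hahn_coeff G a \<noteq> 0" "b \<in> hahn_supp h" "a + b = d + n"
      using that by (auto simp: sum_pairs_def hahn_supp_def)
    have "d \<le> a" "n \<le> b"
      using d(2) n(3) Q[OF ab(1) n(2) ab(3)] ab by blast+
    then show ?thesis
      using ab(3) add_less_le_mono[of d a n b] add_le_less_mono[of d a n b]
      by (auto simp: order_le_less)
  qed
  then have "sum_pairs (hahn_supp G) (hahn_supp h) (d + n) = {(d, n)}"
    using d(1) n(1) by (fastforce simp: sum_pairs_def hahn_supp_def)
  then have "hahn_coeff (G * h) (d + n) = hahn_coeff G d * hahn_coeff h n"
    by (simp add: hahn_coeff_mult[OF wfp_on_hahn_supp wfp_on_hahn_supp order_refl order_refl])
  then show ?thesis
    using n(2) d(1) n(1) by (auto simp: hahn_supp_def)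
qed

text \<open>Well-ordering of the support makes the \<open>LEAST\<close> in \<open>hahn_ord\<close>
  an attained minimum as soon as the support is nonempty.\<close>

lemma hahn_ord_props:
  fixes f :: "('g::linorder, 'k::zero) hahn"
  assumes "hahn_coeff f a \<noteq> 0"
  shows hahn_coeff_hahn_ord: "hahn_coeff f (hahn_ord f) \<noteq> 0" and hahn_ord_le: "hahn_ord f \<le> a"
proof -
  have "a \<in> hahn_supp f" using assms by (simp add: hahn_supp_def)
  then obtain d where d: "d \<in> hahn_supp f" "\<And>t. t \<in> hahn_supp f \<Longrightarrow> d \<le> t"
    using wfp_on_less_leastE[OF wfp_on_hahn_supp order_refl] by (metis empty_iff)
  have "hahn_ord f = d"
    unfolding hahn_ord_def by (rule Least_equality) (use d in \<open>auto simp: hahn_supp_def\<close>)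
  then show "hahn_coeff f (hahn_ord f) \<noteq> 0" "hahn_ord f \<le> a"
    using d assms by (auto simp: hahn_supp_def)
qed

lemma hahn_neq_0_coeff: "f \<noteq> 0 \<Longrightarrow> \<exists>a. hahn_coeff f a \<noteq> 0"
  using hahn_eqI[of f 0] by (auto simp: zero_hahn.rep_eq)

lemma hahn_ord_monom: "c \<noteq> 0 \<Longrightarrow> hahn_ord (hahn_monom e c) = e"
  unfolding hahn_ord_def by (rule Least_equality) (auto simp: hahn_monom.rep_eq split: if_splits)

lemma hahn_coeff_sum: "hahn_coeff (sum f A) n = (\<Sum>i\<in>A. hahn_coeff (f i) n)"
  by (induction A rule: infinite_finite_induct) (simp_all add: zero_hahn.rep_eq plus_hahn.rep_eq)

text \<open>This is \<open>k\<close> times \<open>unit_expvec v\<close>, the exponent vector of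
  \<open>ils_var v ^ k\<close>.\<close>

definition axis_expvec :: "'n \<Rightarrow> nat \<Rightarrow> 'n expvec" where
  "axis_expvec v k = Expvec (\<lambda>i. if i = v then int k else 0)"

lemma expo_axis_expvec: "expo (axis_expvec v k) i = (if i = v then int k else 0)"
  by (simp add: axis_expvec_def Expvec_inverse)

lemma ils_var_power:
  "(ils_var v :: ('k::field, 'n::{finite,linorder}) iterated_laurent) ^ k
     = hahn_monom (axis_expvec v k) 1"
proof (induction k)
  case 0
  have "axis_expvec v 0 = 0"
    by (rule expvec_eqI) (simp add: expo_axis_expvec zero_expvec.rep_eq)
  then show ?case by (simp add: one_hahn_def)
next
  case (Suc k)
  have eq: "n - unit_expvec v = axis_expvec v k \<longleftrightarrow> n = axis_expvec v (Suc k)" for n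
  proof -
    have "axis_expvec v (Suc k) = axis_expvec v k + unit_expvec v"
      by (rule expvec_eqI) (simp add: expo_axis_expvec plus_expvec.rep_eq unit_expvec.rep_eq)
    then show ?thesis by (simp add: diff_eq_eq)
  qed
  show ?case
    by (rule hahn_eqI)
      (simp add: Suc, simp add: ils_var_def hahn_coeff_monom_mult hahn_monom.rep_eq eq)
qed

text \<open>The coefficients of \<open>q\<close> do not involve the variable, so every exponent of
  the \<open>i\<close>-th summand has \<open>v\<close>-component exactly \<open>i\<close>.\<close>

lemma hahn_coeff_poly_ils_var:
  fixes q :: "('k::field, 'n::{finite,linorder}) iterated_laurent poly"
  assumes q: "q \<in> polys_over (ils_without v)"
    and nz: "hahn_coeff (poly q (ils_var v)) n \<noteq> 0"
  shows "0 \<le> expo n v" "expo n v \<le> int (degree q)"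
proof -
  have "(\<Sum>i\<le>degree q. hahn_coeff (coeff q i * ils_var v ^ i) n) \<noteq> 0"
    using nz unfolding poly_altdef hahn_coeff_sum .
  then obtain i where i: "i \<le> degree q" "hahn_coeff (coeff q i * ils_var v ^ i) n \<noteq> 0"
    by (meson atMost_iff sum.not_neutral_contains_not_neutral)
  then have "hahn_coeff (coeff q i) (n - axis_expvec v i) \<noteq> 0"
    by (simp add: mult.commute[of "coeff q i"] ils_var_power hahn_coeff_monom_mult)
  then have "expo (n - axis_expvec v i) v = 0"
    using q by (auto simp: polys_over_def ils_without_def)
  then have "expo n v = int i"
    by (simp add: minus_expvec.rep_eq expo_axis_expvec)
  then show "0 \<le> expo n v" "expo n v \<le> int (degree q)"
    using i(1) by auto
qed

lemma hahn_coeff_ils_PT: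
  "hahn_coeff (ils_PT v F) n = (if expo n v \<ge> 0 then hahn_coeff F n else 0)"
  by (rule ils_PT.rep_eq[THEN fun_cong])

lemma ils_PT_add: "ils_PT v (F + G) = ils_PT v F + ils_PT v G"
  by (rule hahn_eqI) (simp add: hahn_coeff_ils_PT plus_hahn.rep_eq)

lemma ils_PT_0: "ils_PT v 0 = 0"
  by (rule hahn_eqI) (simp add: hahn_coeff_ils_PT zero_hahn.rep_eq)

lemma ils_PT_sum: "ils_PT v (sum F A) = (\<Sum>i\<in>A. ils_PT v (F i))"
  by (induction A rule: infinite_finite_induct) (simp_all add: ils_PT_add ils_PT_0)

lemma ils_PT_eq_self: "(\<And>n. hahn_coeff F n \<noteq> 0 \<Longrightarrow> 0 \<le> expo n v) \<Longrightarrow> ils_PT v F = F"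
  by (rule hahn_eqI) (auto simp: hahn_coeff_ils_PT)

lemma ils_PT_eq_0: "(\<And>n. hahn_coeff F n \<noteq> 0 \<Longrightarrow> expo n v < 0) \<Longrightarrow> ils_PT v F = 0"
  by (rule hahn_eqI) (force simp: hahn_coeff_ils_PT zero_hahn.rep_eq)

lemma ils_PT_poly:
  fixes q :: "('k::field, 'n::{finite,linorder}) iterated_laurent poly"
  assumes "q \<in> polys_over (ils_without v)"
  shows "ils_PT v (poly q (ils_var v)) = poly q (ils_var v)"
  by (rule ils_PT_eq_self) (rule hahn_coeff_poly_ils_var(1)[OF assms])

lemma ils_PT_partial_fraction_prec:
  fixes z :: "('k::field, 'n::{finite,linorder}) iterated_laurent"
  assumes q: "q \<in> polys_over (ils_without v)" and z: "z \<in> ils_without v"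
    and nz: "ils_var v ^ k - z \<noteq> 0" and prec: "z \<prec> ils_var v ^ k"
  shows "ils_PT v (poly q (ils_var v) / (ils_var v ^ k - z)) = poly q (ils_var v) / (ils_var v ^ k - z)"
proof (rule ils_PT_eq_self)
  let ?G = "ils_var v ^ k - z" and ?h = "poly q (ils_var v) / (ils_var v ^ k - z)"
  let ?e = "axis_expvec v k" and ?d = "hahn_ord z"
  have G: "hahn_coeff ?G a = (if a = ?e then 1 else 0) - hahn_coeff z a" for a
    by (simp add: minus_hahn.rep_eq ils_var_power hahn_monom.rep_eq)
  have "z \<noteq> 0" using prec by (simp add: hahn_prec_def)
  then have d: "hahn_coeff z ?d \<noteq> 0" using hahn_neq_0_coeff hahn_coeff_hahn_ord by blast
  \<comment> \<open>The relation \<open>z \<prec> g\<close> also holds when \<open>g = 0\<close>;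
    excluding this turns it into a strict inequality of orders.\<close>
  have "(ils_var v :: ('k, 'n) iterated_laurent) ^ k \<noteq> 0"
  proof
    assume "(ils_var v :: ('k, 'n) iterated_laurent) ^ k = 0"
    then have "hahn_coeff (hahn_monom ?e 1 :: ('k, 'n) iterated_laurent) ?e = 0"
      by (simp add: ils_var_power zero_hahn.rep_eq)
    then show False by (simp add: hahn_monom.rep_eq)
  qed
  then have lt: "?d < ?e"
    using prec by (simp add: hahn_prec_def ils_var_power hahn_ord_monom)
  fix m assume m: "hahn_coeff ?h m \<noteq> 0"
  show "0 \<le> expo m v"
  proof (rule ccontr)
    assume "\<not> 0 \<le> expo m v"
    then have neg: "expo m v < 0" by simp
    have d0: "expo ?d v = 0" using d z by (simp add: ils_without_def)
    have least: "?d \<le> a" if "hahn_coeff ?G a \<noteq> 0" for a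
      using that lt hahn_ord_le[of z a] by (auto simp: G split: if_splits)
    \<comment> \<open>All exponents of the denominator have \<open>v\<close>-component
      \<open>0\<close> or \<open>k\<close>, and \<open>?d\<close> has \<open>0\<close>. Replacing
      \<open>?d\<close> by another one can only lower the \<open>v\<close>-component of the
      complementary exponent.\<close>
    have shift: "expo b v < 0"
      if "hahn_coeff ?G a \<noteq> 0" "expo n v < 0" "a + b = ?d + n" for a b n
    proof -
      have "0 \<le> expo a v"
        using that(1) z by (auto simp: G ils_without_def expo_axis_expvec split: if_splits)
      moreover have "expo a v + expo b v = expo n v"
        using arg_cong[OF that(3), of "\<lambda>x. expo x v"] d0 by (simp add: plus_expvec.rep_eq)
      ultimately show ?thesis using that(2) by linarith
    qed
    \<comment> \<open>As \<open>?d < ?e\<close>, the power of the variable does not touch the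
      leading coefficient of \<open>z\<close>.\<close>
    have "hahn_coeff ?G ?d \<noteq> 0" using d lt by (simp add: G)
    then have "\<exists>n. expo n v < 0 \<and> hahn_coeff (?G * ?h) (?d + n) \<noteq> 0"
      by (rule hahn_coeff_mult_no_cancel[where Q = "\<lambda>n. expo n v < 0" and h = ?h and m = m])
        (fact least shift m neg)+
    then obtain n where n: "expo n v < 0" "hahn_coeff (?G * ?h) (?d + n) \<noteq> 0"
      by blast
    moreover have "?G * ?h = poly q (ils_var v)" using nz by simp
    ultimately show False
      using hahn_coeff_poly_ils_var(1)[OF q, of "?d + n"] d0 by (simp add: plus_expvec.rep_eq)
  qed
qed

lemma ils_PT_partial_fraction_not_prec:
  fixes z :: "('k::field, 'n::{finite,linorder}) iterated_laurent"
  assumes q: "q \<in> polys_over (ils_without v)" and z: "z \<in> ils_without v"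
    and nz: "ils_var v ^ k - z \<noteq> 0" and not_prec: "\<not> z \<prec> ils_var v ^ k"
    and deg: "degree q < k"
  shows "ils_PT v (poly q (ils_var v) / (ils_var v ^ k - z)) = 0"
proof (rule ils_PT_eq_0)
  let ?G = "ils_var v ^ k - z" and ?h = "poly q (ils_var v) / (ils_var v ^ k - z)"
  let ?e = "axis_expvec v k"
  have G: "hahn_coeff ?G a = (if a = ?e then 1 else 0) - hahn_coeff z a" for a
    by (simp add: minus_hahn.rep_eq ils_var_power hahn_monom.rep_eq)
  have e: "expo ?e v = int k" by (simp add: expo_axis_expvec)
  fix m assume m: "hahn_coeff ?h m \<noteq> 0"
  show "expo m v < 0"
  proof (rule ccontr)
    assume "\<not> expo m v < 0"
    then have nonneg: "0 \<le> expo m v" by simp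
    have least: "?e \<le> a" if "hahn_coeff ?G a \<noteq> 0" for a
    proof (cases "a = ?e")
      case False
      then have a: "hahn_coeff z a \<noteq> 0" using that by (simp add: G)
      \<comment> \<open>The negated relation includes \<open>z = 0\<close>, where
        \<open>hahn_ord\<close> is meaningless; a support element of \<open>z\<close> rules this
        out.\<close>
      then have "z \<noteq> 0" by (auto simp: zero_hahn.rep_eq)
      then have "?e \<le> hahn_ord z"
        using not_prec by (auto simp: hahn_prec_def ils_var_power hahn_ord_monom not_less)
      then show ?thesis using hahn_ord_le[OF a] by (rule order_trans)
    qed simp
    \<comment> \<open>Dual to the previous case: now the leading exponent \<open>?e\<close> has the
      largest possible \<open>v\<close>-component, so replacing it can only raise that of the
      complementary exponent.\<close>
    have shift: "0 \<le> expo b v"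
      if "hahn_coeff ?G a \<noteq> 0" "0 \<le> expo n v" "a + b = ?e + n" for a b n
    proof -
      have "expo a v \<le> int k"
        using that(1) z e by (auto simp: G ils_without_def split: if_splits)
      moreover have "expo a v + expo b v = int k + expo n v"
        using arg_cong[OF that(3), of "\<lambda>x. expo x v"] e by (simp add: plus_expvec.rep_eq)
      ultimately show ?thesis using that(2) by linarith
    qed
    \<comment> \<open>The bound \<open>degree q < k\<close> forces \<open>k > 0\<close>, so
      \<open>?e\<close> involves the variable and \<open>z\<close> cannot cancel the term
      there.\<close>
    have "hahn_coeff z ?e = 0" using z e deg by (auto simp: ils_without_def)
    then have "hahn_coeff ?G ?e \<noteq> 0" by (simp add: G)
    then have "\<exists>n. 0 \<le> expo n v \<and> hahn_coeff (?G * ?h) (?e + n) \<noteq> 0"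
      by (rule hahn_coeff_mult_no_cancel[where Q = "\<lambda>n. 0 \<le> expo n v" and h = ?h and m = m])
        (fact least shift m nonneg)+
    then obtain n where n: "0 \<le> expo n v" "hahn_coeff (?G * ?h) (?e + n) \<noteq> 0"
      by blast
    moreover have "?G * ?h = poly q (ils_var v)" using nz by simp
    ultimately show False
      using hahn_coeff_poly_ils_var(2)[OF q, of "?e + n"] e deg by (simp add: plus_expvec.rep_eq)
  qed
qed

theorem mainTheorem14:
  fixes v :: "'n::{finite,linorder}"
    and F lam :: "('k::field_char_0, 'n) iterated_laurent"
    and L :: "('k, 'n) iterated_laurent set"
    and P f :: "('k, 'n) iterated_laurent poly"
    and p :: "nat \<Rightarrow> ('k, 'n) iterated_laurent poly"
    and z :: "nat \<Rightarrow> ('k, 'n) iterated_laurent"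
    and j :: "nat \<Rightarrow> nat" and n :: nat
  defines "lam \<equiv> ils_var v" and "L \<equiv> ils_without v"
  assumes "P \<in> polys_over L"
    and "\<And>i. i \<in> {1..n} \<Longrightarrow> z i \<in> L"
    and "\<And>i. i \<in> {1..n} \<Longrightarrow> lam ^ j i - z i \<noteq> 0"
    and "F = poly P lam / (\<Prod>i=1..n. lam ^ j i - z i)"
    and "pairwise (\<lambda>i i'. coprime_over L (monom 1 (j i) - [:z i:]) (monom 1 (j i') - [:z i':])) {1..n}"
    and "f \<in> polys_over L"
    and "\<And>i. i \<in> {1..n} \<Longrightarrow> p i \<in> polys_over L"
    and "\<And>i. i \<in> {1..n} \<Longrightarrow> p i = 0 \<or> degree (p i) < j i"
    and "F = poly f lam + (\<Sum>i=1..n. poly (p i) lam / (lam ^ j i - z i))"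
  shows "ils_PT v F =
    poly f lam + (\<Sum>i | i \<in> {1..n} \<and> z i \<prec> lam ^ j i. poly (p i) lam / (lam ^ j i - z i))"
proof -
  have summand: "ils_PT v (poly (p i) lam / (lam ^ j i - z i)) =
      (if z i \<prec> lam ^ j i then poly (p i) lam / (lam ^ j i - z i) else 0)" if i: "i \<in> {1..n}" for i
  \<comment> \<open>Since \<open>degree 0 = 0\<close>, the zero numerator violates the strict bound
    when \<open>j i = 0\<close> and is treated separately.\<close>
  proof (cases "p i = 0")
    case True
    then show ?thesis by (simp add: ils_PT_0)
  next
    case False
    then have deg: "degree (p i) < j i" using assms(10)[OF i] by simp
    show ?thesis
      using ils_PT_partial_fraction_prec ils_PT_partial_fraction_not_prec[OF _ _ _ _ deg]
        assms(4,5,9)[OF i] unfolding lam_def L_def by auto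
  qed
  \<comment> \<open>\<open>ils_PT\<close> is additive and fixes the polynomial part, so only the
    fractions remain.\<close>
  have "ils_PT v F = poly f lam + (\<Sum>i=1..n. ils_PT v (poly (p i) lam / (lam ^ j i - z i)))"
    using ils_PT_poly[of f v] assms(8) unfolding assms(11) ils_PT_add ils_PT_sum
    by (simp add: lam_def L_def)
  also have "\<dots> = poly f lam +
      (\<Sum>i=1..n. if z i \<prec> lam ^ j i then poly (p i) lam / (lam ^ j i - z i) else 0)"
    by (simp add: summand)
  finally show ?thesis
    by (simp only: sum.inter_filter[OF finite_atLeastAtMost])
qed

end
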